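(* Let $T$ be an in-tree (anti-arborescence) with $n$ vertices and $l$ leaves. Then $\chi_{d}(T)=n-l+1$.
   Context: All digraphs are orientations of finite simple trees. An in-tree (anti-arborescence) is an orientation of a tree in which all arcs point towards a single sink (the root). A leaf of an in-tree is a vertex of in-degree zero (so the root is not counted as a leaf, even if its degree is one, unless the tree is a single vertex, which is regarded as having one leaf). For a vertex $v$ of a digraph $D$, $N^{+}(v)$ denotes the open out-neighborhood, i.e. the set of vertices $w$ such that $(v,w)$ is an arc; $v$ dominates each vertex of $N^{+}(v)$. A dominator coloring of $D$ is a proper vertex coloring (adjacent vertices of the underlying graph receive different colors) such that every vertex $v$ with $N^{+}(v)\neq\emptyset$ dominates at least one color class, i.e. there is a nonempty color class contained in $N^{+}(v)$ (vertices of out-degree zero are exempt). The dominator chromatic number $\chi_{d}(D)$ is the minimum number of colors in a dominator coloring of $D$. *)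

theory Defs
  imports "Graph_Theory.Digraph_Component"
begin

text \<open>
  The library predicates \<^const>\<open>forest\<close> and \<^const>\<open>tree\<close> only exclude directed cycles, and the
  symmetric digraph \<^const>\<open>mk_symmetric\<close> has a directed cycle of length 2 for each edge.  The
  cycles of the underlying simple graph are the cycles of \<^const>\<open>mk_symmetric\<close> of length at least 3.
\<close>

definition underlying_acyclic :: "('a, 'b) pre_digraph \<Rightarrow> bool" where
  "underlying_acyclic G \<longleftrightarrow>
     \<not> (\<exists>p. pre_digraph.cycle (with_proj (mk_symmetric G)) p \<and> length p \<ge> 3)"

text \<open>
  The locale predicate \<^const>\<open>digraph\<close> means finite, without loops and without parallel arcs;
  \<^const>\<open>connected\<close> is weak connectedness and includes that there is at least one vertex.
\<close>

definition oriented_tree :: "('a, 'b) pre_digraph \<Rightarrow> bool" where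
  "oriented_tree G \<longleftrightarrow>
     digraph G \<and> (\<forall>u v. u \<rightarrow>\<^bsub>G\<^esub> v \<longrightarrow> \<not> v \<rightarrow>\<^bsub>G\<^esub> u) \<and> connected G \<and> underlying_acyclic G"

definition in_tree :: "('a, 'b) pre_digraph \<Rightarrow> bool" where
  "in_tree G \<longleftrightarrow>
     oriented_tree G \<and>
     (\<exists>r \<in> verts G. out_degree G r = 0 \<and> (\<forall>v \<in> verts G. v \<rightarrow>\<^sup>*\<^bsub>G\<^esub> r))"

definition leaves :: "('a, 'b) pre_digraph \<Rightarrow> 'a set" where
  "leaves G = {v \<in> verts G. in_degree G v = 0}"

definition out_nbhd :: "('a, 'b) pre_digraph \<Rightarrow> 'a \<Rightarrow> 'a set" where
  "out_nbhd G v = {w. v \<rightarrow>\<^bsub>G\<^esub> w}"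

definition proper_coloring :: "('a, 'b) pre_digraph \<Rightarrow> ('a \<Rightarrow> nat) \<Rightarrow> bool" where
  "proper_coloring G c \<longleftrightarrow> (\<forall>u v. u \<rightarrow>\<^bsub>G\<^esub> v \<longrightarrow> c u \<noteq> c v)"

definition color_classes :: "('a, 'b) pre_digraph \<Rightarrow> ('a \<Rightarrow> nat) \<Rightarrow> 'a set set" where
  "color_classes G c = (\<lambda>i. {w \<in> verts G. c w = i}) ` (c ` verts G)"

definition dominator_coloring :: "('a, 'b) pre_digraph \<Rightarrow> ('a \<Rightarrow> nat) \<Rightarrow> bool" where
  "dominator_coloring G c \<longleftrightarrow>
     proper_coloring G c \<and>
     (\<forall>v \<in> verts G. out_nbhd G v \<noteq> {} \<longrightarrow> (\<exists>C \<in> color_classes G c. C \<subseteq> out_nbhd G v))"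

text \<open>
  On a finite loop-free digraph a coloring that is injective on the vertices is a dominator
  coloring, so the minimum below is attained.
\<close>

definition dominator_chromatic_number :: "('a, 'b) pre_digraph \<Rightarrow> nat" where
  "dominator_chromatic_number G =
     (LEAST k. \<exists>c. dominator_coloring G c \<and> card (c ` verts G) = k)"

end

theory Submission
  imports Defs
begin

text \<open>
  In an in-tree every vertex other than the root has exactly one out-neighbour, its parent.  If
  \<open>w\<close> is not a leaf, some \<open>u\<close> has \<open>w\<close> as its only out-neighbour, and the colour class that \<open>u\<close>
  dominates can only be \<open>{w}\<close>.  Hence in a dominator colouring each of the \<open>n - l\<close> vertices that
  are not leaves has a colour of its own, and a leaf needs one colour more.  There is a leaf,
  because the parent function on the \<open>n - 1\<close> other vertices cannot reach all \<open>n\<close> vertices.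
  Conversely, no arc enters a leaf, so all leaves may share one colour; with the
  other vertices in singleton classes, every vertex but the root dominates the class of its parent.

  The colouring argument is elementary; the work lies in \<open>in_tree_unique_out_neighbour\<close>, which
  derives uniqueness of the parent from the absence of cycles in the underlying graph.  If \<open>v\<close> had
  out-neighbours \<open>w \<noteq> w'\<close>, one could go from \<open>w\<close> down to the root and from there back up to
  \<open>w'\<close> and \<open>v\<close>, without using the edge between \<open>v\<close> and \<open>w\<close>; by
  \<open>bypassed_arc_imp_underlying_cycle\<close> this edge would then lie on a cycle.
\<close>

section \<open>Edges on cycles of the underlying graph\<close>

text \<open>
  A path from \<open>v\<close> back to \<open>u\<close> that repeats no vertex has at least two arcs, since the edge itself
  is not available to it; the arc \<open>(u, v)\<close> closes it to a cycle of length at least three.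
\<close>

lemma bypassed_arc_imp_underlying_cycle:
  assumes "wf_digraph G" and "u \<noteq> v" and arc: "u \<rightarrow>\<^bsub>G\<^esub> v"
    and detour: "(v, u) \<in> (parcs (mk_symmetric G) - {(u, v), (v, u)})\<^sup>*"
  shows "\<not> underlying_acyclic G"
proof -
  interpret wf_digraph G by fact
  interpret M: pair_wf_digraph "mk_symmetric G" ..
  define H where
    "H = \<lparr>pverts = verts G, parcs = parcs (mk_symmetric G) - {(u, v), (v, u)}\<rparr>"
  interpret H: pair_wf_digraph H
    by unfold_locales (auto simp: H_def dest: M.in_arcsD1 M.in_arcsD2)
  have "v \<in> verts G" using arc by (rule adj_in_verts)
  then have "v \<rightarrow>\<^sup>*\<^bsub>with_proj H\<^esub> u"
    using detour by (subst H.reachable_conv') (simp_all add: H_def)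
  then obtain p where p: "H.apath v p u" by (auto simp: H.reachable_apath)
  then have in_H: "set p \<subseteq> parcs H" and walk: "pcas v p u"
    and dist: "distinct (pawalk_verts v p)"
    by (auto simp: H.apath_def H.awalk_def)
  have "p \<noteq> []" using walk \<open>u \<noteq> v\<close> by auto
  moreover have "p \<noteq> [e]" for e
    using walk in_H by (cases e) (auto simp: H_def)
  ultimately have "length ((u, v) # p) \<ge> 3"
    by (cases p rule: remdups_adj.cases) auto
  moreover have "M.cycle ((u, v) # p)"
    unfolding M.cycle_def
  proof (intro exI conjI)
    have "(u, v) \<in> parcs (mk_symmetric G)"
      using arc by (auto simp: parcs_mk_symmetric arcs_ends_conv)
    then show "M.awalk u ((u, v) # p) u"
      using in_H walk by (auto simp: M.awalk_def H_def dest: M.in_arcsD1)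
    show "distinct (tl (M.awalk_verts u ((u, v) # p)))"
      using dist by simp
  qed simp
  ultimately show ?thesis unfolding underlying_acyclic_def by blast
qed

text \<open>
  The next two facts reroute walks around the arcs to be avoided: a walk can be started at its last
  visit to the start vertex, and it never leaves a vertex that it does not reach.
\<close>

lemma rtrancl_avoid_start:
  assumes "(x, y) \<in> R\<^sup>*"
  shows "(x, y) \<in> {(a, b) \<in> R. b \<noteq> x}\<^sup>*"
  using assms
proof induction
  case (step y z)
  then show ?case by (cases "z = x") (auto intro: rtrancl_into_rtrancl)
qed simp

lemma rtrancl_avoid_unreachable:
  assumes "(x, y) \<in> R\<^sup>*" and "(x, v) \<notin> R\<^sup>*"
  shows "(x, y) \<in> {(a, b) \<in> R. a \<noteq> v}\<^sup>*"
  using assms(1)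
proof induction
  case (step y z)
  with assms(2) have "y \<noteq> v" by auto
  with step show ?case by (auto intro: rtrancl_into_rtrancl)
qed simp

section \<open>Parents and leaves in an in-tree\<close>

text \<open>
  A directed walk from \<open>w\<close> back to \<open>v\<close> that never re-enters \<open>w\<close> cannot use the edge between the two:
  the arc \<open>(v, w)\<close> enters \<open>w\<close>, and the orientation excludes the arc \<open>(w, v)\<close>.
\<close>

lemma oriented_tree_no_return:
  assumes "oriented_tree G" and arc: "v \<rightarrow>\<^bsub>G\<^esub> w"
  shows "(w, v) \<notin> (arcs_ends G)\<^sup>*"
proof
  assume "(w, v) \<in> (arcs_ends G)\<^sup>*"
  then have walk: "(w, v) \<in> {(a, b) \<in> arcs_ends G. b \<noteq> w}\<^sup>*"
    by (rule rtrancl_avoid_start)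
  interpret digraph G using assms(1) by (simp add: oriented_tree_def)
  have "(w, v) \<notin> arcs_ends G" "underlying_acyclic G"
    using assms by (auto simp: oriented_tree_def)
  moreover have "{(a, b) \<in> arcs_ends G. b \<noteq> w}
      \<subseteq> parcs (mk_symmetric G) - {(v, w), (w, v)}"
    using calculation(1) by (auto simp: parcs_mk_symmetric arcs_ends_conv)
  then have "(w, v) \<in> (parcs (mk_symmetric G) - {(v, w), (w, v)})\<^sup>*"
    using walk rtrancl_mono by blast
  moreover have "v \<noteq> w" using arc adj_not_same by blast
  ultimately show False
    using bypassed_arc_imp_underlying_cycle[OF wf_digraph _ arc] by blast
qed

lemma in_tree_unique_out_neighbour:
  assumes tree: "in_tree G" and arc: "v \<rightarrow>\<^bsub>G\<^esub> w" and arc': "v \<rightarrow>\<^bsub>G\<^esub> w'"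
  shows "w = w'"
proof (rule ccontr)
  assume "w \<noteq> w'"
  have otree: "oriented_tree G" using tree by (simp add: in_tree_def)
  then interpret digraph G by (simp add: oriented_tree_def)
  have acyclic: "underlying_acyclic G" and no_rev: "(w, v) \<notin> arcs_ends G"
    using otree arc by (auto simp: oriented_tree_def)
  obtain r where root: "\<And>x. x \<in> verts G \<Longrightarrow> (x, r) \<in> (arcs_ends G)\<^sup>*"
    using tree by (auto simp: in_tree_def intro: reachable_rtranclI)
  define S where "S = parcs (mk_symmetric G) - {(v, w), (w, v)}"
  have arc_in_S: "(a, b) \<in> S" if "(a, b) \<in> arcs_ends G" "(a, b) \<noteq> (v, w)" for a b
    using that no_rev by (auto simp: S_def parcs_mk_symmetric arcs_ends_conv)
  have "sym S"
    by (auto simp: S_def sym_def parcs_mk_symmetric)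
  have "(w, r) \<in> {(a, b) \<in> arcs_ends G. b \<noteq> w}\<^sup>*"
    by (rule rtrancl_avoid_start, rule root, rule adj_in_verts) (rule arc)
  moreover have "{(a, b) \<in> arcs_ends G. b \<noteq> w} \<subseteq> S"
    using arc_in_S by auto
  ultimately have down: "(w, r) \<in> S\<^sup>*" using rtrancl_mono by blast
  \<comment> \<open>Walking down from \<open>w'\<close>, one never meets \<open>v\<close> and hence never uses the arc \<open>(v, w)\<close>.\<close>
  have "(w', r) \<in> {(a, b) \<in> arcs_ends G. a \<noteq> v}\<^sup>*"
    using root adj_in_verts(2)[OF arc'] oriented_tree_no_return[OF otree arc']
    by (blast intro: rtrancl_avoid_unreachable)
  moreover have "{(a, b) \<in> arcs_ends G. a \<noteq> v} \<subseteq> S"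
    using arc_in_S by auto
  ultimately have "(w', r) \<in> S\<^sup>*" using rtrancl_mono by blast
  moreover have "(v, w') \<in> S" using arc_in_S arc' \<open>w \<noteq> w'\<close> by blast
  ultimately have "(v, r) \<in> S\<^sup>*" by (rule converse_rtrancl_into_rtrancl[rotated])
  then have "(r, v) \<in> S\<^sup>*" using \<open>sym S\<close> sym_rtrancl by (blast dest: symD)
  with down have "(w, v) \<in> S\<^sup>*" by (rule rtrancl_trans)
  moreover have "v \<noteq> w" using arc adj_not_same by blast
  ultimately show False
    using bypassed_arc_imp_underlying_cycle[OF wf_digraph _ arc] acyclic
    by (auto simp: S_def)
qed

lemma (in fin_digraph) leaf_iff_no_in_neighbour:
  "v \<in> leaves G \<longleftrightarrow> v \<in> verts G \<and> (\<forall>u. \<not> u \<rightarrow>\<^bsub>G\<^esub> v)"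
  unfolding leaves_def in_degree_def
  by (auto simp: card_eq_0_iff finite_in_arcs arcs_ends_conv in_arcs_def)

lemma in_tree_leaves_nonempty:
  assumes tree: "in_tree G"
  shows "leaves G \<noteq> {}"
proof
  assume no_leaf: "leaves G = {}"
  interpret digraph G using tree by (simp add: in_tree_def oriented_tree_def)
  obtain r where r: "r \<in> verts G" "out_degree G r = 0"
    using tree by (auto simp: in_tree_def)
  then have no_out: "\<not> r \<rightarrow>\<^bsub>G\<^esub> w" for w
    by (auto simp: out_degree_def card_eq_0_iff finite_out_arcs out_arcs_def arcs_ends_conv)
  define parent where "parent u = (THE w. u \<rightarrow>\<^bsub>G\<^esub> w)" for u
  have parent: "parent u = w" if "u \<rightarrow>\<^bsub>G\<^esub> w" for u w
    unfolding parent_def using that in_tree_unique_out_neighbour[OF tree]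
    by (intro the_equality) auto
  have "verts G \<subseteq> parent ` (verts G - {r})"
  proof
    fix w assume "w \<in> verts G"
    then obtain u where u: "u \<rightarrow>\<^bsub>G\<^esub> w" using no_leaf leaf_iff_no_in_neighbour by blast
    then have "u \<in> verts G - {r}" using no_out adj_in_verts by blast
    then show "w \<in> parent ` (verts G - {r})" using parent[OF u] by blast
  qed
  then have "card (verts G) \<le> card (verts G - {r})"
    by (rule surj_card_le[rotated]) simp
  then show False using r(1) by (metis card_Diff1_less finite_verts leD)
qed

section \<open>Dominator colourings of in-trees\<close>

text \<open>
  A child of \<open>w\<close> has out-neighbourhood \<open>{w}\<close>, and the class that the child dominates lies inside it.
\<close>

lemma in_tree_non_leaf_own_colour:
  assumes tree: "in_tree G" and dom: "dominator_coloring G c"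
    and w: "w \<in> verts G - leaves G" and x: "x \<in> verts G" "c x = c w"
  shows "x = w"
proof -
  interpret digraph G using tree by (simp add: in_tree_def oriented_tree_def)
  obtain u where u: "u \<rightarrow>\<^bsub>G\<^esub> w" using w leaf_iff_no_in_neighbour by blast
  then have nbhd: "out_nbhd G u = {w}"
    using in_tree_unique_out_neighbour[OF tree] by (auto simp: out_nbhd_def)
  have "u \<in> verts G" using u by (rule adj_in_verts)
  with dom nbhd obtain C where C: "C \<in> color_classes G c" "C \<subseteq> {w}"
    unfolding dominator_coloring_def by force
  then obtain y where y: "y \<in> verts G" "C = {z \<in> verts G. c z = c y}"
    by (auto simp: color_classes_def)
  then have "y = w" using C(2) by blast
  then show ?thesis using y C(2) x by blast
qed

lemma in_tree_dominator_coloring_lower_bound: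
  assumes tree: "in_tree G" and dom: "dominator_coloring G c"
  shows "card (verts G - leaves G) + 1 \<le> card (c ` verts G)"
proof -
  interpret digraph G using tree by (simp add: in_tree_def oriented_tree_def)
  obtain z where z: "z \<in> leaves G" using in_tree_leaves_nonempty[OF tree] by blast
  then have z_vert: "z \<in> verts G" by (simp add: leaves_def)
  note own = in_tree_non_leaf_own_colour[OF tree dom]
  have "inj_on c (insert z (verts G - leaves G))"
    using own z_vert by (intro inj_onI) (metis DiffE insertE)
  then have "card (c ` insert z (verts G - leaves G)) = card (verts G - leaves G) + 1"
    using z by (simp only: card_image) simp
  moreover have "card (c ` insert z (verts G - leaves G)) \<le> card (c ` verts G)"
    using z_vert by (intro card_mono) auto
  ultimately show ?thesis by simp
qed

text \<open>
  The colour 0 is reserved for the leaves.  Every out-neighbour has an entering arc and is thus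
  not a leaf, so it is dominated as a singleton class; this holds in any digraph that has a leaf.
\<close>

lemma (in digraph) dominator_coloring_leaves_monochromatic:
  assumes "leaves G \<noteq> {}"
  obtains c where "dominator_coloring G c"
    and "card (c ` verts G) = card (verts G - leaves G) + 1"
proof -
  obtain f :: "'a \<Rightarrow> nat" where f: "inj_on f (verts G)"
    using finite_imp_inj_to_nat_seg[OF finite_verts] by blast
  define c where "c w = (if w \<in> leaves G then 0 else Suc (f w))" for w
  have target: "w \<in> verts G - leaves G" if "u \<rightarrow>\<^bsub>G\<^esub> w" for u w
    using that leaf_iff_no_in_neighbour adj_in_verts by blast
  have same_colour: "x = w" if "w \<in> verts G - leaves G" "x \<in> verts G" "c x = c w" for x w
    using that f by (auto simp: c_def inj_on_def split: if_splits)
  have "dominator_coloring G c"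
    unfolding dominator_coloring_def
  proof (intro conjI ballI impI)
    show "proper_coloring G c"
      unfolding proper_coloring_def
      using same_colour target adj_in_verts adj_not_same by metis
    fix v assume "v \<in> verts G" "out_nbhd G v \<noteq> {}"
    then obtain w where w: "v \<rightarrow>\<^bsub>G\<^esub> w" by (auto simp: out_nbhd_def)
    have "{x \<in> verts G. c x = c w} \<in> color_classes G c"
      using target[OF w] by (auto simp: color_classes_def)
    moreover have "{x \<in> verts G. c x = c w} \<subseteq> out_nbhd G v"
      using same_colour[OF target[OF w]] w by (auto simp: out_nbhd_def)
    ultimately show "\<exists>C \<in> color_classes G c. C \<subseteq> out_nbhd G v" by blast
  qed
  moreover have "c ` verts G = insert 0 (Suc ` f ` (verts G - leaves G))"
    using assms by (force simp: c_def leaves_def)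
  moreover have "card (Suc ` f ` (verts G - leaves G)) = card (verts G - leaves G)"
    using inj_on_diff[OF f] by (simp add: card_image)
  ultimately show thesis by (intro that) auto
qed

theorem lemma1:
  fixes T :: "('a, 'b) pre_digraph" and n l :: nat
  assumes "in_tree T"
    and "card (verts T) = n"
    and "card (leaves T) = l"
  shows "int (dominator_chromatic_number T) = int n - int l + 1"
proof -
  interpret digraph T using assms(1) by (simp add: in_tree_def oriented_tree_def)
  have "dominator_chromatic_number T = card (verts T - leaves T) + 1"
    unfolding dominator_chromatic_number_def
  proof (rule Least_equality)
    show "\<exists>c. dominator_coloring T c \<and> card (c ` verts T) = card (verts T - leaves T) + 1"
      using dominator_coloring_leaves_monochromatic in_tree_leaves_nonempty[OF assms(1)]
      by metis
  qed (use in_tree_dominator_coloring_lower_bound[OF assms(1)] in blast)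
  moreover have sub: "leaves T \<subseteq> verts T" by (auto simp: leaves_def)
  then have "card (verts T - leaves T) = n - l" "l \<le> n"
    using assms(2,3) finite_verts
    by (auto simp: card_Diff_subset finite_subset intro: card_mono)
  ultimately show ?thesis by simp
qed

end
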